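(* Let $k\ge 2$ and let $r_1,\dots,r_k$ be integers with $2\le r_1\le\dots\le r_k$; put $n=r_1+\dots+r_k$. Let $G$ be the complete $k$-partite graph with vertex set $V_1\cup\dots\cup V_k$ (disjoint union), $|V_i|=r_i$, let $K$ be a field, and let $I\subset S=K[x_1,\dots,x_n]$ be the edge ideal of $G$, i.e. $I=\sum_{1\le i<j\le k} I_i\cap I_j$, where $I_i$ is the ideal generated by the variables $x_{r_1+\dots+r_{i-1}+1},\dots,x_{r_1+\dots+r_i}$. Then $$\operatorname{sdepth}(I)\le 2+\frac{\binom{n}{3}-\sum_{i=1}^k\binom{r_i}{3}}{\sum_{1\le i<j\le k} r_i r_j}.$$
   Context: Binomial coefficients $\binom{a}{b}$ with $a<b$ are $0$. A complete $k$-partite graph is a graph whose vertex set $V$ is partitioned into $k$ disjoint subsets $V_1,\dots,V_k$ and whose edge set is $E=\{\{u,v\}: u\in V_i,\ v\in V_j,\ i\ne j\}$. The edge ideal of a graph on vertices $v_1,\dots,v_n$ is the squarefree monomial ideal $(x_ix_j:\{v_i,v_j\}\in E)$ of $S=K[x_1,\dots,x_n]$; here vertices are numbered so that the vertices of $V_i$ correspond to the variables generating $I_i$. Stanley depth: let $M$ be a finitely generated $\mathbb{Z}^n$-graded $S$-module. For a homogeneous element $u\in M$ and a subset $Z\subset\{x_1,\dots,x_n\}$, let $uK[Z]$ be the $K$-subspace of $M$ consisting of all elements $uf$ with $f\in K[Z]$. It is called a Stanley space of dimension $|Z|$ if $uK[Z]$ is a free $K[Z]$-module. A Stanley decomposition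 of $M$ is a presentation of the $K$-vector space $M$ as a finite direct sum of Stanley spaces $\mathcal{D}: M=\bigoplus_{i=1}^r u_iK[Z_i]$. Put $\operatorname{sdepth}(\mathcal{D})=\min\{|Z_i|: i=1,\dots,r\}$ and $\operatorname{sdepth}(M)=\max\{\operatorname{sdepth}(\mathcal{D}):\mathcal{D}\text{ is a Stanley decomposition of }M\}$. *)

theory Defs
  imports Complex_Main "HOL-Library.Poly_Mapping" "HOL-Library.FuncSet" "HOL-Library.Disjoint_Sets"
begin

text \<open>
  The polynomial ring \<open>S = K[x\<^sub>v | v]\<close>: the variables are indexed by the elements of a finite type
  \<open>'v\<close>, so that \<open>n = CARD('v)\<close>. A power product is a finitely supported function from variables to
  exponents, a polynomial a finitely supported function from power products to coefficients,
  and the multiplication of \<^theory>\<open>HOL-Library.Poly_Mapping\<close> is convolution.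
\<close>

type_synonym ('v, 'k) poly_ring = "('v \<Rightarrow>\<^sub>0 nat) \<Rightarrow>\<^sub>0 'k"

definition var :: "'v \<Rightarrow> ('v, 'k::field) poly_ring" where
  "var v = Poly_Mapping.single (Poly_Mapping.single v 1) 1"

text \<open>The subring \<open>K[Z]\<close>; in particular \<open>K[{}] = K\<close> consists of the constants.\<close>

definition subpolys :: "'v set \<Rightarrow> ('v, 'k::field) poly_ring set" where
  "subpolys Z = {p. \<forall>m \<in> Poly_Mapping.keys p. Poly_Mapping.keys m \<subseteq> Z}"

definition exponent :: "('v \<Rightarrow>\<^sub>0 nat) \<Rightarrow> 'v \<Rightarrow> int" where
  "exponent m = (\<lambda>v. int (Poly_Mapping.lookup m v))"


text \<open>
  A finitely generated \<open>\<int>\<^sup>n\<close>-graded \<open>S\<close>-module, given as a submodule \<open>M\<close> of the ambient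
  module \<open>'m\<close> with components \<open>component a\<close> for \<open>a \<in> \<int>\<^sup>n\<close>. Since the component \<open>S\<^sub>b\<close> is spanned
  over \<open>K\<close> by the monomial \<open>x\<^sup>b\<close> (and is zero if \<open>b\<close> has a negative entry),
  \<open>scale_component\<close> says \<open>S\<^sub>b M\<^sub>a \<subseteq> M\<^sub>a\<^sub>+\<^sub>b\<close>.
\<close>

locale multigraded_module = module scale
  for scale :: "('v::finite, 'k::field) poly_ring \<Rightarrow> 'm::ab_group_add \<Rightarrow> 'm" (infixr \<open>*s\<close> 75) +
  fixes M :: "'m set"
    and component :: "('v \<Rightarrow> int) \<Rightarrow> 'm set"
  assumes submodule: "subspace M"
    and finitely_generated: "\<exists>B. finite B \<and> span B = M"
    and component_subset: "component a \<subseteq> M"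
    and component_zero: "0 \<in> component a"
    and component_add: "u \<in> component a \<Longrightarrow> w \<in> component a \<Longrightarrow> u + w \<in> component a"
    and scale_component: "u \<in> component a \<Longrightarrow>
      Poly_Mapping.single m c *s u \<in> component (\<lambda>v. a v + exponent m v)"
    and direct_sum: "u \<in> M \<Longrightarrow>
      \<exists>!w. (\<forall>a. w a \<in> component a) \<and> finite {a. w a \<noteq> 0} \<and> u = (\<Sum>a | w a \<noteq> 0. w a)"
begin

definition homogeneous :: "'m \<Rightarrow> bool" where
  "homogeneous u \<longleftrightarrow> (\<exists>a. u \<in> component a)"

definition mult_space :: "'m \<Rightarrow> 'v set \<Rightarrow> 'm set" where
  "mult_space u Z = (\<lambda>f. f *s u) ` subpolys Z"

text \<open>
  A \<open>K[Z]\<close>-submodule is free iff it has a basis, i.e. a subset \<open>B\<close> such that every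
  element is in a unique way a finite linear combination of \<open>B\<close> with coefficients in \<open>K[Z]\<close>.
\<close>

definition free_over :: "'v set \<Rightarrow> 'm set \<Rightarrow> bool" where
  "free_over Z N \<longleftrightarrow> (\<exists>B \<subseteq> N. \<forall>w \<in> N. \<exists>!c.
     (\<forall>b. c b \<in> subpolys Z) \<and> finite {b. c b \<noteq> 0} \<and> {b. c b \<noteq> 0} \<subseteq> B \<and>
     w = (\<Sum>b | c b \<noteq> 0. c b *s b))"

definition stanley_space :: "'m \<Rightarrow> 'v set \<Rightarrow> bool" where
  "stanley_space u Z \<longleftrightarrow> u \<in> M \<and> homogeneous u \<and> free_over Z (mult_space u Z)"

text \<open>
  A nonempty list \<open>[(u\<^sub>1, Z\<^sub>1), \<dots>, (u\<^sub>r, Z\<^sub>r)]\<close> stands for the decomposition \<open>M = \<Oplus> u\<^sub>i K[Z\<^sub>i]\<close>.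
  A zero generator gives the zero module, which is free; for \<open>M \<noteq> 0\<close> such summands
  can be dropped without decreasing the minimum below, so they do not influence the depth of \<open>M\<close>.
\<close>

definition stanley_decomposition :: "('m \<times> 'v set) list \<Rightarrow> bool" where
  "stanley_decomposition D \<longleftrightarrow> D \<noteq> [] \<and>
     (\<forall>(u, Z) \<in> set D. stanley_space u Z) \<and>
     (\<forall>w \<in> M. \<exists>!f. f \<in> (\<Pi>\<^sub>E i\<in>{..<length D}. mult_space (fst (D ! i)) (snd (D ! i))) \<and>
        w = (\<Sum>i<length D. f i))"

definition decomposition_sdepth :: "('m \<times> 'v set) list \<Rightarrow> nat" where
  "decomposition_sdepth D = Min ((\<lambda>(u, Z). card Z) ` set D)"

text \<open>The set below is finite, as all its elements are at most \<open>CARD('v)\<close>.\<close>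

definition sdepth :: nat where
  "sdepth = Max {decomposition_sdepth D | D. stanley_decomposition D}"

end


text \<open>Ideals of \<open>S\<close> are the submodules of \<open>S\<close> over itself, generated ideals are spans.\<close>

global_interpretation poly_ideal: module "(*) :: ('v, 'k::field) poly_ring \<Rightarrow> _"
  defines ideal = poly_ideal.span
  by standard (simp_all add: algebra_simps)

text \<open>The \<open>\<int>\<^sup>n\<close>-grading that a monomial ideal inherits from \<open>S\<close>.\<close>

definition ideal_comp :: "('v, 'k::field) poly_ring set \<Rightarrow> ('v \<Rightarrow> int) \<Rightarrow> ('v, 'k) poly_ring set" where
  "ideal_comp I a = {p \<in> I. \<forall>m \<in> Poly_Mapping.keys p. exponent m = a}"

abbreviation ideal_sdepth :: "('v::finite, 'k::field) poly_ring set \<Rightarrow> nat" where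
  "ideal_sdepth I \<equiv> multigraded_module.sdepth (*) I (ideal_comp I)"


text \<open>
  A graph is given by its set of edges, which are two-element sets of vertices; the vertices are
  the elements of \<open>'v\<close>, and the vertex \<open>v\<close> corresponds to the variable \<open>var v\<close>.
\<close>

definition complete_partite_edges :: "nat \<Rightarrow> (nat \<Rightarrow> 'v set) \<Rightarrow> 'v set set" where
  "complete_partite_edges k V =
     {{u, v} | u v i j. i \<in> {1..k} \<and> j \<in> {1..k} \<and> i \<noteq> j \<and> u \<in> V i \<and> v \<in> V j}"

definition edge_ideal :: "'v set set \<Rightarrow> ('v, 'k::field) poly_ring set" where
  "edge_ideal E = ideal {var u * var v | u v. {u, v} \<in> E}"


subsection \<open>Consistency of the definitions\<close>

lemma monomial_ideal_iff:
  fixes p :: "('v, 'k::field) poly_ring"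
  shows "p \<in> ideal ((\<lambda>a. Poly_Mapping.single a 1) ` A) \<longleftrightarrow>
    (\<forall>m \<in> Poly_Mapping.keys p. \<exists>a \<in> A. \<exists>b. m = a + b)" (is "p \<in> ideal ?G \<longleftrightarrow> ?P p")
proof
  assume "p \<in> ideal ?G"
  then show "?P p"
  proof (induction rule: poly_ideal.span_induct_alt)
    case base
    then show ?case by simp
  next
    case (step c x y)
    then obtain a where a: "a \<in> A" "x = Poly_Mapping.single a 1" by auto
    show ?case
    proof
      fix m assume "m \<in> Poly_Mapping.keys (c * x + y)"
      then have "m \<in> Poly_Mapping.keys (c * x) \<or> m \<in> Poly_Mapping.keys y"
        using Poly_Mapping.keys_add[of "c * x" y] by auto
      then show "\<exists>a \<in> A. \<exists>b. m = a + b"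
      proof
        assume "m \<in> Poly_Mapping.keys (c * x)"
        then obtain b where "m = b + a"
          using Poly_Mapping.keys_mult[of c x] a by auto
        then show ?thesis using a(1) add.commute[of b a] by blast
      next
        assume "m \<in> Poly_Mapping.keys y"
        then show ?thesis using step by blast
      qed
    qed
  qed
next
  assume P: "?P p"
  have "p = (\<Sum>m \<in> Poly_Mapping.keys p. Poly_Mapping.single m (Poly_Mapping.lookup p m))"
  proof (rule poly_mapping_eqI)
    fix l
    show "Poly_Mapping.lookup p l = Poly_Mapping.lookup
        (\<Sum>m \<in> Poly_Mapping.keys p. Poly_Mapping.single m (Poly_Mapping.lookup p m)) l"
      unfolding Poly_Mapping.lookup_sum lookup_single when_def
      by (subst sum.delta) (auto simp: in_keys_iff)
  qed
  also have "\<dots> \<in> ideal ?G"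
  proof (rule poly_ideal.span_sum)
    fix m assume "m \<in> Poly_Mapping.keys p"
    then obtain a b where ab: "a \<in> A" "m = a + b" using P by blast
    have "Poly_Mapping.single m (Poly_Mapping.lookup p m) =
        Poly_Mapping.single b (Poly_Mapping.lookup p m) * Poly_Mapping.single a 1"
      by (simp add: ab mult_single add.commute)
    then show "Poly_Mapping.single m (Poly_Mapping.lookup p m) \<in> ideal ?G"
      using ab(1) by (simp add: poly_ideal.span_scale poly_ideal.span_base)
  qed
  finally show "p \<in> ideal ?G" .
qed

lemma var_ideal_iff:
  fixes p :: "('v, 'k::field) poly_ring"
  shows "p \<in> ideal (var ` A) \<longleftrightarrow>
    (\<forall>m \<in> Poly_Mapping.keys p. \<exists>v \<in> A. \<exists>b. m = Poly_Mapping.single v 1 + b)"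
proof -
  have "(var ` A :: ('v, 'k) poly_ring set) =
      (\<lambda>a. Poly_Mapping.single a 1) ` ((\<lambda>v. Poly_Mapping.single v 1) ` A)"
    by (auto simp: var_def image_image)
  then show ?thesis using monomial_ideal_iff[of p "(\<lambda>v. Poly_Mapping.single v 1) ` A"] by simp
qed

lemma edge_ideal_generators:
  "{var u * var v | u v. {u, v} \<in> E} = (\<lambda>a. Poly_Mapping.single a 1) `
     {Poly_Mapping.single u 1 + Poly_Mapping.single v 1 | u v. {u, v} \<in> E}"
  by (auto simp: var_def mult_single image_iff)

lemma edge_ideal_iff:
  "p \<in> edge_ideal E \<longleftrightarrow> (\<forall>m \<in> Poly_Mapping.keys p.
     \<exists>u v b. {u, v} \<in> E \<and> m = Poly_Mapping.single u 1 + Poly_Mapping.single v 1 + b)"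
  unfolding edge_ideal_def edge_ideal_generators monomial_ideal_iff by blast

text \<open>\<open>ideal_sdepth\<close> is applied to a module satisfying the axioms above.\<close>

lemma multigraded_module_edge_ideal:
  "multigraded_module (*) (edge_ideal E) (ideal_comp (edge_ideal E :: ('v::finite, 'k::field) poly_ring set))"
proof
  let ?I = "edge_ideal E :: ('v, 'k) poly_ring set"
  show "poly_ideal.subspace ?I"
    unfolding edge_ideal_def by (rule poly_ideal.subspace_span)
  have "finite {var u * var v :: ('v, 'k) poly_ring | u v. {u, v} \<in> E}"
    by (rule finite_subset[OF _ finite_imageI[OF finite[of UNIV], of "\<lambda>(u, v). var u * var v"]]) auto
  then show "\<exists>B. finite B \<and> module.span (*) B = ?I"
    unfolding edge_ideal_def ideal_def by blast
  show "ideal_comp ?I a \<subseteq> ?I" for a by (auto simp: ideal_comp_def)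
  show "0 \<in> ideal_comp ?I a" for a by (simp add: ideal_comp_def edge_ideal_iff)
  show "u + w \<in> ideal_comp ?I a" if "u \<in> ideal_comp ?I a" "w \<in> ideal_comp ?I a" for u w a
  proof -
    have "u + w \<in> ?I"
      using that by (auto simp: ideal_comp_def edge_ideal_def intro: poly_ideal.span_add)
    then show ?thesis using that Poly_Mapping.keys_add[of u w] by (auto simp: ideal_comp_def)
  qed
  show "Poly_Mapping.single m c * u \<in> ideal_comp ?I (\<lambda>v. a v + exponent m v)"
    if "u \<in> ideal_comp ?I a" for u a m c
  proof -
    have "Poly_Mapping.single m c * u \<in> ?I"
      using that by (auto simp: ideal_comp_def edge_ideal_def intro: poly_ideal.span_scale)
    moreover have "exponent l = (\<lambda>v. a v + exponent m v)"
      if "l \<in> Poly_Mapping.keys (Poly_Mapping.single m c * u)" for l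
    proof -
      from that obtain b where "b \<in> Poly_Mapping.keys u" "l = m + b"
        using Poly_Mapping.keys_mult[of "Poly_Mapping.single m c" u] by (auto split: if_splits)
      then show ?thesis using \<open>u \<in> ideal_comp ?I a\<close>
        by (auto simp: ideal_comp_def exponent_def lookup_add fun_eq_iff)
    qed
    ultimately show ?thesis by (simp add: ideal_comp_def)
  qed
  fix p assume p: "p \<in> ?I"
  define w0 where "w0 = (\<lambda>a. \<Sum>m | m \<in> Poly_Mapping.keys p \<and> exponent m = a.
      Poly_Mapping.single m (Poly_Mapping.lookup p m))"
  have lookup_w: "Poly_Mapping.lookup (w0 a) m =
      (if exponent m = a then Poly_Mapping.lookup p m else 0)" for a m
    unfolding w0_def Poly_Mapping.lookup_sum lookup_single when_def
    by (subst sum.delta) (auto simp: in_keys_iff)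
  have keys_w: "Poly_Mapping.keys (w0 a) = {m \<in> Poly_Mapping.keys p. exponent m = a}" for a
    by (auto simp: in_keys_iff lookup_w split: if_splits)
  have lookup_sum_eq: "Poly_Mapping.lookup (\<Sum>a | w a \<noteq> 0. w a) m =
      Poly_Mapping.lookup (w (exponent m)) m"
    if w: "\<forall>a. w a \<in> ideal_comp ?I a" and fin: "finite {a. w a \<noteq> 0}" for w m
  proof -
    have "Poly_Mapping.lookup (w a) m = 0" if "a \<noteq> exponent m" for a
      using w that by (auto simp: ideal_comp_def in_keys_iff)
    then have "Poly_Mapping.lookup (w a) m =
        (if a = exponent m then Poly_Mapping.lookup (w a) m else 0)" for a
      by auto
    then have "Poly_Mapping.lookup (\<Sum>a | w a \<noteq> 0. w a) m =
        (\<Sum>a | w a \<noteq> 0. if a = exponent m then Poly_Mapping.lookup (w a) m else 0)"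
      unfolding Poly_Mapping.lookup_sum by (intro sum.cong) auto
    also have "\<dots> = Poly_Mapping.lookup (w (exponent m)) m"
      by (subst sum.delta[OF fin]) auto
    finally show ?thesis .
  qed
  show "\<exists>!w. (\<forall>a. w a \<in> ideal_comp ?I a) \<and> finite {a. w a \<noteq> 0} \<and> p = (\<Sum>a | w a \<noteq> 0. w a)"
  proof (rule ex1I[of _ w0])
    have 1: "\<forall>a. w0 a \<in> ideal_comp ?I a"
      using p by (auto simp: ideal_comp_def edge_ideal_iff keys_w)
    have "{a. w0 a \<noteq> 0} \<subseteq> exponent ` Poly_Mapping.keys p"
    proof
      fix a assume "a \<in> {a. w0 a \<noteq> 0}"
      then have "Poly_Mapping.keys (w0 a) \<noteq> {}" by simp
      then show "a \<in> exponent ` Poly_Mapping.keys p" unfolding keys_w by auto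
    qed
    then have 2: "finite {a. w0 a \<noteq> 0}" by (rule finite_subset) simp
    have "p = (\<Sum>a | w0 a \<noteq> 0. w0 a)"
    proof (rule poly_mapping_eqI)
      fix m show "Poly_Mapping.lookup p m = Poly_Mapping.lookup (\<Sum>a | w0 a \<noteq> 0. w0 a) m"
        unfolding lookup_sum_eq[OF 1 2] lookup_w by simp
    qed
    with 1 2 show "(\<forall>a. w0 a \<in> ideal_comp ?I a) \<and> finite {a. w0 a \<noteq> 0} \<and> p = (\<Sum>a | w0 a \<noteq> 0. w0 a)"
      by blast
  next
    fix w assume w: "(\<forall>a. w a \<in> ideal_comp ?I a) \<and> finite {a. w a \<noteq> 0} \<and> p = (\<Sum>a | w a \<noteq> 0. w a)"
    show "w = w0"
    proof
      fix a show "w a = w0 a"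
      proof (rule poly_mapping_eqI)
        fix m
        have "Poly_Mapping.lookup p m = Poly_Mapping.lookup (w (exponent m)) m"
          using lookup_sum_eq[of w m] w by (elim conjE) simp
        moreover have "Poly_Mapping.lookup (w a) m = 0" if "a \<noteq> exponent m"
          using w that by (auto simp: ideal_comp_def in_keys_iff)
        ultimately show "Poly_Mapping.lookup (w a) m = Poly_Mapping.lookup (w0 a) m"
          unfolding lookup_w by auto
      qed
    qed
  qed
qed

text \<open>The edge ideal of the complete \<open>k\<close>-partite graph is the sum of the ideals \<open>I\<^sub>i \<inter> I\<^sub>j\<close>, \<open>i < j\<close>.\<close>

lemma edge_ideal_complete_partite:
  assumes "disjoint_family_on V {1..k}"
  shows "(edge_ideal (complete_partite_edges k V) :: ('v, 'k::field) poly_ring set) =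
    ideal (\<Union>i\<in>{1..k}. \<Union>j\<in>{i<..k}. ideal (var ` V i) \<inter> ideal (var ` V j))"
    (is "?I = ideal ?U")
proof
  have "var u * var v \<in> ?U" if "{u, v} \<in> complete_partite_edges k V" for u v
  proof -
    from that obtain i j where ij: "i \<in> {1..k}" "j \<in> {1..k}" "i \<noteq> j" "u \<in> V i" "v \<in> V j"
      by (auto simp: complete_partite_edges_def doubleton_eq_iff)
    have "var u * var v \<in> ideal (var ` V j)"
      using ij by (auto intro: poly_ideal.span_scale poly_ideal.span_base)
    moreover have "var v * var u \<in> ideal (var ` V i)"
      using ij by (auto intro: poly_ideal.span_scale poly_ideal.span_base)
    ultimately have *: "var u * var v \<in> ideal (var ` V i) \<inter> ideal (var ` V j)"
      by (simp add: mult.commute)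
    show ?thesis
    proof (cases "i < j")
      case True then show ?thesis using * ij by force
    next
      case False then show ?thesis using * ij by (intro UN_I[of j] UN_I[of i]) auto
    qed
  qed
  then show "?I \<subseteq> ideal ?U"
    unfolding edge_ideal_def by (intro poly_ideal.span_mono) auto
next
  show "ideal ?U \<subseteq> ?I"
  proof (rule poly_ideal.span_minimal)
    show "poly_ideal.subspace ?I"
      unfolding edge_ideal_def by (rule poly_ideal.subspace_span)
    show "?U \<subseteq> ?I"
    proof
      fix p assume "p \<in> ?U"
      then obtain i j where ij: "i \<in> {1..k}" "j \<in> {1..k}" "i < j"
        and p: "p \<in> ideal (var ` V i)" "p \<in> ideal (var ` V j)" by auto
      show "p \<in> ?I"
        unfolding edge_ideal_iff
      proof
        fix m assume m: "m \<in> Poly_Mapping.keys p"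
        obtain u b where u: "u \<in> V i" "m = Poly_Mapping.single u 1 + b"
          using p(1) m unfolding var_ideal_iff by blast
        obtain v c where v: "v \<in> V j" "m = Poly_Mapping.single v 1 + c"
          using p(2) m unfolding var_ideal_iff by blast
        have "V i \<inter> V j = {}" using assms ij by (intro disjoint_family_onD[of V "{1..k}"]) auto
        then have "u \<noteq> v" using u(1) v(1) by blast
        then have "Poly_Mapping.lookup b v \<noteq> 0"
        proof -
          have "Poly_Mapping.lookup m v = Poly_Mapping.lookup b v"
            using \<open>u \<noteq> v\<close> by (simp add: u(2) lookup_add lookup_single)
          then show ?thesis by (simp add: v(2) lookup_add)
        qed
        then have "b = Poly_Mapping.single v 1 + (b - Poly_Mapping.single v 1)"
          by (intro poly_mapping_eqI) (auto simp: lookup_add lookup_minus lookup_single when_def)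
        then have "m = Poly_Mapping.single u 1 + Poly_Mapping.single v 1 +
            (b - Poly_Mapping.single v 1)"
          using u(2) by (metis add.assoc)
        moreover have "{u, v} \<in> complete_partite_edges k V"
          unfolding complete_partite_edges_def using ij u(1) v(1) by fastforce
        ultimately show "\<exists>u v b. {u, v} \<in> complete_partite_edges k V \<and>
            m = Poly_Mapping.single u 1 + Poly_Mapping.single v 1 + b" by blast
      qed
    qed
  qed
qed

end

theory Submission
  imports Defs
begin

text \<open>
  The bound comes from looking only at squarefree monomials of degree two and three.
  In a \<open>\<int>\<^sup>n\<close>-graded Stanley decomposition every nonzero generator is a scalar multiple of a
  monomial, so the decomposition amounts to a partition of the monomials of \<open>I\<close> into cones
  \<open>a + \<nat>\<^sup>Z\<close> (\<open>stanley_decomposition_covers\<close>, \<open>stanley_decomposition_disjoint\<close>). The monomials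
  \<open>x\<^sub>u x\<^sub>v\<close> of the edges have the least degree in \<open>I\<close>; hence each of them can only lie in a cone of
  which it is itself the apex, and different edges use different cones. If all the sets \<open>Z\<close> have at
  least \<open>s\<close> elements, the cone with apex \<open>x\<^sub>u x\<^sub>v\<close> contains at least \<open>s - 2\<close> squarefree monomials
  \<open>x\<^sub>u x\<^sub>v x\<^sub>w\<close>, namely those with \<open>w \<in> Z - {u, v}\<close>. As cones are disjoint, no such monomial is counted
  twice, and \<open>(s - 2) |E|\<close> is at most the number of vertex triples that contain an edge
  (\<open>edge_ideal_decomposition_bound\<close>).

  This holds for every graph with an edge. For a complete multipartite graph the triples without an edge are
  those inside a single part, which gives \<open>(n choose 3) - \<Sum> (r\<^sub>i choose 3)\<close> triples with an edge, and
  there are \<open>\<Sum> r\<^sub>i r\<^sub>j\<close> edges.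

  The Stanley depth is a maximum, which is attained only if the ideal has some
  Stanley decomposition. One is obtained by sorting the monomials of \<open>I\<close> by their support \<open>F\<close>: those
  with support exactly \<open>F\<close> form the cone \<open>a + \<nat>\<^sup>F\<close>, where \<open>a\<close> is the exponent of the product
  of the variables in \<open>F\<close> (\<open>edge_ideal_decomposition_exists\<close>).
\<close>

section \<open>Multiples of a monomial\<close>

lemma sum_monomials:
  "(\<Sum>m\<in>Poly_Mapping.keys p. Poly_Mapping.single m (Poly_Mapping.lookup p m)) = p"
  by (rule poly_mapping_eqI)
    (simp add: Poly_Mapping.lookup_sum lookup_single when_def in_keys_iff)

text \<open>
  Multiplication by a monomial with coefficient 1 only shifts the coefficients, so it is injective.
\<close>

lemma lookup_times_single:
  fixes f :: "'a::cancel_comm_monoid_add \<Rightarrow>\<^sub>0 'b::semiring_0"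
  shows "Poly_Mapping.lookup (f * Poly_Mapping.single a c) (a + b) = Poly_Mapping.lookup f b * c"
proof -
  have "Poly_Mapping.lookup (f * Poly_Mapping.single a c) (a + b) =
      (\<Sum>m\<in>Poly_Mapping.keys f. if m = b then Poly_Mapping.lookup f m * c else 0)"
    by (subst sum_monomials[symmetric])
      (auto simp: sum_distrib_right Poly_Mapping.lookup_sum mult_single lookup_single when_def
        add.commute[of _ a] intro: sum.cong)
  also have "\<dots> = Poly_Mapping.lookup f b * c"
    by (simp add: in_keys_iff)
  finally show ?thesis .
qed

text \<open>The exponents of the monomials in \<open>x\<^sup>a K[Z]\<close>.\<close>

definition cone :: "('v \<Rightarrow>\<^sub>0 nat) \<Rightarrow> 'v set \<Rightarrow> ('v \<Rightarrow>\<^sub>0 nat) set" where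
  "cone a Z = {a + b | b. Poly_Mapping.keys b \<subseteq> Z}"

lemma times_single_subpolys:
  fixes c :: "'k::field" and a :: "'v \<Rightarrow>\<^sub>0 nat"
  assumes "c \<noteq> 0"
  shows "(\<lambda>f. f * Poly_Mapping.single a c) ` subpolys Z = {p. Poly_Mapping.keys p \<subseteq> cone a Z}"
proof (intro equalityI subsetI)
  fix p assume "p \<in> (\<lambda>f. f * Poly_Mapping.single a c) ` subpolys Z"
  then obtain f where f: "f \<in> subpolys Z" "p = f * Poly_Mapping.single a c" by auto
  have "m \<in> cone a Z" if "m \<in> Poly_Mapping.keys p" for m
  proof -
    have "m \<in> {b + a | b. b \<in> Poly_Mapping.keys f}"
      using that Poly_Mapping.keys_mult[of f "Poly_Mapping.single a c"] assms
      unfolding f(2) by auto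
    then obtain b where "b \<in> Poly_Mapping.keys f" "m = a + b"
      using add.commute[of _ a] by auto
    then show ?thesis using f(1) by (auto simp: subpolys_def cone_def)
  qed
  then show "p \<in> {p. Poly_Mapping.keys p \<subseteq> cone a Z}" by auto
next
  fix p :: "('v, 'k) poly_ring"
  assume p: "p \<in> {p. Poly_Mapping.keys p \<subseteq> cone a Z}"
  define f where "f = (\<Sum>m\<in>Poly_Mapping.keys p.
    Poly_Mapping.single (m - a) (Poly_Mapping.lookup p m / c))"
  have shift: "m - a + a = m \<and> Poly_Mapping.keys (m - a) \<subseteq> Z" if "m \<in> Poly_Mapping.keys p" for m
  proof -
    obtain b where "Poly_Mapping.keys b \<subseteq> Z" "m = a + b"
      using p \<open>m \<in> Poly_Mapping.keys p\<close> unfolding cone_def by blast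
    then show ?thesis by (simp add: add.commute)
  qed
  have "Poly_Mapping.keys f \<subseteq> (\<Union>m\<in>Poly_Mapping.keys p.
      Poly_Mapping.keys (Poly_Mapping.single (m - a) (Poly_Mapping.lookup p m / c)))"
    unfolding f_def by (rule Poly_Mapping.keys_sum)
  then have "f \<in> subpolys Z"
    using shift by (fastforce simp: subpolys_def split: if_splits)
  moreover have "f * Poly_Mapping.single a c =
      (\<Sum>m\<in>Poly_Mapping.keys p. Poly_Mapping.single m (Poly_Mapping.lookup p m))"
    unfolding f_def sum_distrib_right using assms shift
    by (intro sum.cong) (auto simp: mult_single)
  moreover have "\<dots> = p"
    by (rule sum_monomials)
  ultimately show "p \<in> (\<lambda>f. f * Poly_Mapping.single a c) ` subpolys Z"
    by (intro image_eqI[of _ _ f]) simp_all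
qed

section \<open>Stanley decompositions of monomial ideals as partitions into cones\<close>

locale monomial_ideal = multigraded_module "(*)" I "ideal_comp I"
  for I :: "('v::finite, 'k::field) poly_ring set" +
  fixes A :: "('v \<Rightarrow>\<^sub>0 nat) set"
  assumes I_eq: "I = {p. Poly_Mapping.keys p \<subseteq> A}"
begin

lemma mult_space_single:
  "c \<noteq> 0 \<Longrightarrow> mult_space (Poly_Mapping.single a c) Z = {p. Poly_Mapping.keys p \<subseteq> cone a Z}"
  unfolding mult_space_def by (rule times_single_subpolys)

lemma cone_subset:
  assumes "a \<in> A"
  shows "cone a Z \<subseteq> A"
proof
  fix m assume "m \<in> cone a Z"
  then obtain b where m: "m = a + b" by (auto simp: cone_def)
  have "Poly_Mapping.single a 1 \<in> I" using assms by (simp add: I_eq)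
  then have "Poly_Mapping.single b 1 * Poly_Mapping.single a 1 \<in> I"
    by (rule subspace_scale[OF submodule])
  then show "m \<in> A" by (simp add: I_eq m mult_single add.commute)
qed

lemma zero_in_mult_space: "0 \<in> mult_space u Z"
  unfolding mult_space_def by (rule image_eqI[of _ _ 0]) (auto simp: subpolys_def)

text \<open>The components of the fine grading of \<open>S\<close> are at most one-dimensional over \<open>K\<close>.\<close>

lemma homogeneous_is_monomial:
  assumes "homogeneous u" "u \<noteq> 0"
  obtains a c where "c \<noteq> 0" "u = Poly_Mapping.single a c"
proof -
  obtain m where m: "m \<in> Poly_Mapping.keys u" using assms(2) by fastforce
  have "m' = m" if "m' \<in> Poly_Mapping.keys u" for m'
  proof -
    have "exponent m' = exponent m"
      using assms(1) m that by (auto simp: homogeneous_def ideal_comp_def)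
    then show ?thesis by (intro poly_mapping_eqI) (auto simp: exponent_def fun_eq_iff)
  qed
  then have "u = Poly_Mapping.single m (Poly_Mapping.lookup u m)"
    by (intro poly_mapping_eqI) (auto simp: lookup_single when_def in_keys_iff)
  then show thesis using that m by (metis in_keys_iff)
qed

text \<open>
  In the expression of a monomial \<open>x\<^sup>m\<close> as a sum of elements of the Stanley spaces, some summand
  has a nonzero coefficient at \<open>m\<close>; its generator is then nonzero, hence a monomial up to a scalar.
\<close>

lemma stanley_decomposition_covers:
  assumes D: "stanley_decomposition D" and m: "m \<in> A"
  obtains i a c where "i < length D" "c \<noteq> 0" "fst (D ! i) = Poly_Mapping.single a c"
    "a \<in> A" "m \<in> cone a (snd (D ! i))"
proof -
  have "Poly_Mapping.single m 1 \<in> I" using m by (simp add: I_eq)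
  then obtain f where f: "f \<in> (\<Pi>\<^sub>E i\<in>{..<length D}. mult_space (fst (D ! i)) (snd (D ! i)))"
    "Poly_Mapping.single m 1 = (\<Sum>i<length D. f i)"
    using D unfolding stanley_decomposition_def by meson
  have "(\<Sum>i<length D. Poly_Mapping.lookup (f i) m) = 1"
    by (metis f(2) Poly_Mapping.lookup_sum lookup_single_eq)
  then obtain i where i: "i < length D" "Poly_Mapping.lookup (f i) m \<noteq> 0"
    by (metis (no_types, lifting) lessThan_iff sum.neutral zero_neq_one)
  let ?u = "fst (D ! i)"
  have fi: "f i \<in> mult_space ?u (snd (D ! i))" using f(1) i(1) by auto
  then have "?u \<noteq> 0" using i(2) by (auto simp: mult_space_def)
  moreover have u: "?u \<in> I" "homogeneous ?u"
    using D nth_mem[OF i(1)] unfolding stanley_decomposition_def stanley_space_def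
    by (metis (no_types, lifting) case_prodE fst_conv)+
  ultimately obtain a c where ac: "c \<noteq> 0" "?u = Poly_Mapping.single a c"
    using homogeneous_is_monomial by blast
  then have "m \<in> cone a (snd (D ! i))"
    using fi i(2) by (auto simp: mult_space_single in_keys_iff)
  moreover have "a \<in> A" using u(1) ac by (simp add: I_eq)
  ultimately show thesis using that i(1) ac by blast
qed

text \<open>A monomial in two cones would have two expressions, each with a single nonzero summand.\<close>

lemma stanley_decomposition_disjoint:
  assumes D: "stanley_decomposition D" and m: "m \<in> A"
    and i: "i < length D" "c \<noteq> 0" "fst (D ! i) = Poly_Mapping.single a c"
      "m \<in> cone a (snd (D ! i))"
    and j: "j < length D" "d \<noteq> 0" "fst (D ! j) = Poly_Mapping.single b d"
      "m \<in> cone b (snd (D ! j))"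
  shows "i = j"
proof -
  let ?x = "Poly_Mapping.single m 1 :: ('v, 'k) poly_ring"
  define g where "g h = (\<lambda>l\<in>{..<length D}. if l = h then ?x else 0)" for h
  let ?Q = "\<lambda>f. f \<in> (\<Pi>\<^sub>E l\<in>{..<length D}. mult_space (fst (D ! l)) (snd (D ! l))) \<and>
      ?x = (\<Sum>l<length D. f l)"
  have "?x \<in> I" using m by (simp add: I_eq)
  then have ex1: "\<exists>!f. ?Q f"
    using D by (simp add: stanley_decomposition_def)
  have "?x \<in> mult_space (fst (D ! i)) (snd (D ! i))" "?x \<in> mult_space (fst (D ! j)) (snd (D ! j))"
    using i j by (auto simp: mult_space_single)
  then have "?Q (g i)" "?Q (g j)"
    using i(1) j(1) by (auto simp: g_def zero_in_mult_space)
  then have "g i = g j"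
    by (rule trans[OF the1_equality[OF ex1, symmetric] the1_equality[OF ex1]])
  then have "g i i = g j i" by simp
  moreover have "?x \<noteq> 0" by (metis keys_single keys_zero insert_not_empty zero_neq_one)
  ultimately show ?thesis using i(1) by (simp add: g_def split: if_splits)
qed

text \<open>Freeness holds with the generator as basis, since multiplication by a monomial is injective.\<close>

lemma stanley_space_monomial:
  assumes "a \<in> A"
  shows "stanley_space (Poly_Mapping.single a 1) Z"
proof -
  let ?u = "Poly_Mapping.single a 1 :: ('v, 'k) poly_ring"
  have "?u \<in> I" using assms by (simp add: I_eq)
  moreover have "homogeneous ?u"
    using \<open>?u \<in> I\<close> by (auto simp: homogeneous_def ideal_comp_def intro!: exI[of _ "exponent a"])
  moreover have "free_over Z (mult_space ?u Z)"
    unfolding free_over_def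
  proof (intro exI[of _ "{?u}"] conjI ballI)
    show "{?u} \<subseteq> mult_space ?u Z"
      by (auto simp: mult_space_single cone_def intro: exI[of _ 0])
  next
    fix w assume "w \<in> mult_space ?u Z"
    then obtain f where f: "f \<in> subpolys Z" "w = f * ?u" by (auto simp: mult_space_def)
    have sum_eq: "(\<Sum>b | c b \<noteq> 0. c b * b) = c ?u * ?u"
      if "{b. c b \<noteq> 0} \<subseteq> {?u}" for c :: "('v, 'k) poly_ring \<Rightarrow> ('v, 'k) poly_ring"
    proof -
      have "(\<Sum>b | c b \<noteq> 0. c b * b) = (\<Sum>b\<in>{?u}. c b * b)"
        by (rule sum.mono_neutral_left) (use that in auto)
      then show ?thesis by simp
    qed
    show "\<exists>!c. (\<forall>b. c b \<in> subpolys Z) \<and> finite {b. c b \<noteq> 0} \<and> {b. c b \<noteq> 0} \<subseteq> {?u} \<and>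
        w = (\<Sum>b | c b \<noteq> 0. c b * b)"
    proof (rule ex1I[of _ "\<lambda>b. if b = ?u then f else 0"])
      have "{b. (if b = ?u then f else 0) \<noteq> 0} \<subseteq> {?u}" by auto
      then show "(\<forall>b. (if b = ?u then f else 0) \<in> subpolys Z) \<and>
          finite {b. (if b = ?u then f else 0) \<noteq> 0} \<and> {b. (if b = ?u then f else 0) \<noteq> 0} \<subseteq> {?u} \<and>
          w = (\<Sum>b | (if b = ?u then f else 0) \<noteq> 0. (if b = ?u then f else 0) * b)"
        using f sum_eq[of "\<lambda>b. if b = ?u then f else 0"]
        by (auto simp: subpolys_def intro: finite_subset)
    next
      fix c assume c: "(\<forall>b. c b \<in> subpolys Z) \<and> finite {b. c b \<noteq> 0} \<and> {b. c b \<noteq> 0} \<subseteq> {?u} \<and>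
        w = (\<Sum>b | c b \<noteq> 0. c b * b)"
      then have "c ?u * ?u = f * ?u" using sum_eq[of c] f(2) by metis
      then have "c ?u = f"
        by (intro poly_mapping_eqI) (metis lookup_times_single mult.right_neutral)
      then show "c = (\<lambda>b. if b = ?u then f else 0)" using c by (auto simp: fun_eq_iff)
    qed
  qed
  ultimately show ?thesis by (simp add: stanley_space_def)
qed

text \<open>
  The converse of \<open>stanley_decomposition_covers\<close> and \<open>stanley_decomposition_disjoint\<close> for
  cones with apex in \<open>A\<close>. A polynomial is split by sending each of its
  terms to the unique cone containing it.
\<close>

lemma stanley_decompositionI:
  fixes cs :: "(('v \<Rightarrow>\<^sub>0 nat) \<times> 'v set) list"
  assumes "cs \<noteq> []"
    and gens: "\<And>a Z. (a, Z) \<in> set cs \<Longrightarrow> a \<in> A"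
    and part: "\<And>m. m \<in> A \<Longrightarrow> \<exists>!i. i < length cs \<and> m \<in> cone (fst (cs ! i)) (snd (cs ! i))"
  shows "stanley_decomposition (map (\<lambda>(a, Z). (Poly_Mapping.single a 1, Z)) cs)"
proof -
  let ?D = "map (\<lambda>(a, Z). (Poly_Mapping.single a 1 :: ('v, 'k) poly_ring, Z)) cs"
  let ?C = "\<lambda>i. cone (fst (cs ! i)) (snd (cs ! i))"
  have space: "mult_space (fst (?D ! i)) (snd (?D ! i)) = {p. Poly_Mapping.keys p \<subseteq> ?C i}"
    if "i < length cs" for i
    using that by (simp add: mult_space_single split_beta)
  \<comment> \<open>the number of the cone that contains \<open>m\<close>; meaningful for \<open>m \<in> A\<close> only\<close>
  define idx where "idx m = (THE i. i < length cs \<and> m \<in> ?C i)" for m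
  have idx: "idx m < length cs" "m \<in> ?C (idx m)"
    and idx_eq: "i < length cs \<Longrightarrow> m \<in> ?C i \<Longrightarrow> i = idx m" if "m \<in> A" for m i
    using theI'[OF part[OF that]] part[OF that] unfolding idx_def by blast+
  have "\<exists>!f. f \<in> (\<Pi>\<^sub>E i\<in>{..<length ?D}. mult_space (fst (?D ! i)) (snd (?D ! i))) \<and>
        w = (\<Sum>i<length ?D. f i)" (is "\<exists>!f. f \<in> ?P \<and> _") if w: "w \<in> I" for w
  proof -
    have wA: "Poly_Mapping.lookup w m = 0" if "m \<notin> A" for m
      using w that by (auto simp: I_eq in_keys_iff)
    \<comment> \<open>A summand is determined by the sum: it is the part of \<open>w\<close> on the monomials of its cone.\<close>
    have lookup_f: "Poly_Mapping.lookup (\<Sum>i<length cs. f i) m = Poly_Mapping.lookup (f (idx m)) m"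
      if f: "\<And>i. i < length cs \<Longrightarrow> Poly_Mapping.keys (f i) \<subseteq> ?C i" and m: "m \<in> A"
      for f :: "nat \<Rightarrow> ('v, 'k) poly_ring" and m
    proof -
      have "Poly_Mapping.lookup (f i) m = 0" if "i < length cs" "i \<noteq> idx m" for i
        using f[OF that(1)] idx_eq[OF m that(1)] that(2) by (auto simp: in_keys_iff)
      then have "(\<Sum>i<length cs. Poly_Mapping.lookup (f i) m) =
          (\<Sum>i\<in>{idx m}. Poly_Mapping.lookup (f i) m)"
        using idx(1)[OF m] by (intro sum.mono_neutral_right) auto
      then show ?thesis by (simp add: Poly_Mapping.lookup_sum)
    qed
    define f0 where "f0 = (\<lambda>i\<in>{..<length cs}. \<Sum>m | m \<in> Poly_Mapping.keys w \<and> idx m = i.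
      Poly_Mapping.single m (Poly_Mapping.lookup w m))"
    have lookup_f0: "Poly_Mapping.lookup (f0 i) m =
        (if idx m = i then Poly_Mapping.lookup w m else 0)" if "i < length cs" for i m
      using that unfolding f0_def
      by (simp add: Poly_Mapping.lookup_sum lookup_single when_def)
         (auto simp: in_keys_iff)
    have keys_f0: "Poly_Mapping.keys (f0 i) \<subseteq> ?C i" if "i < length cs" for i
    proof
      fix m assume "m \<in> Poly_Mapping.keys (f0 i)"
      then have "idx m = i" "Poly_Mapping.lookup w m \<noteq> 0"
        using lookup_f0[OF that] by (auto simp: in_keys_iff split: if_splits)
      then show "m \<in> ?C i" using wA idx(2) by metis
    qed
    have f0: "f0 \<in> ?P"
      by (rule PiE_I) (use keys_f0 space in \<open>auto simp: f0_def\<close>)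
    have outside: "Poly_Mapping.lookup (f i) m = 0"
      if "f \<in> ?P" "i < length cs" "m \<notin> A" for f :: "nat \<Rightarrow> ('v, 'k) poly_ring" and i m
    proof -
      have "?C i \<subseteq> A"
        using gens nth_mem[OF that(2)] by (intro cone_subset) (metis prod.collapse)
      then show ?thesis
        using PiE_mem[OF that(1), of i] space[OF that(2)] that(2,3) by (auto simp: in_keys_iff)
    qed
    have "w = (\<Sum>i<length cs. f0 i)"
    proof (rule poly_mapping_eqI)
      fix m
      show "Poly_Mapping.lookup w m = Poly_Mapping.lookup (\<Sum>i<length cs. f0 i) m"
      proof (cases "m \<in> A")
        case True
        then show ?thesis using lookup_f[of f0 m] keys_f0 lookup_f0 idx(1) by simp
      next
        case False
        then show ?thesis using wA lookup_f0 by (simp add: Poly_Mapping.lookup_sum)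
      qed
    qed
    moreover have "f = f0" if f: "f \<in> ?P" and wf: "w = (\<Sum>i<length cs. f i)" for f
    proof (rule PiE_ext[of f "{..<length ?D}" "\<lambda>i. mult_space (fst (?D ! i)) (snd (?D ! i))"])
      show "f \<in> ?P" "f0 \<in> ?P" by fact+
      fix i assume "i \<in> {..<length ?D}"
      then have i: "i < length cs" by simp
      have keys_f: "Poly_Mapping.keys (f i) \<subseteq> ?C i" if "i < length cs" for i
        using PiE_mem[OF f, of i] that space[OF that] by simp
      show "f i = f0 i"
      proof (rule poly_mapping_eqI)
        fix m
        show "Poly_Mapping.lookup (f i) m = Poly_Mapping.lookup (f0 i) m"
        proof (cases "m \<in> A")
          case True
          have "Poly_Mapping.lookup w m = Poly_Mapping.lookup (f (idx m)) m"
            using lookup_f[of f m] keys_f True wf by simp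
          moreover have "Poly_Mapping.lookup (f i) m = 0" if "idx m \<noteq> i"
            using keys_f[OF i] idx_eq[OF True i] that by (auto simp: in_keys_iff)
          ultimately show ?thesis using lookup_f0[OF i] by auto
        next
          case False
          then show ?thesis using outside f f0 i by simp
        qed
      qed
    qed
    ultimately show ?thesis using f0 by (intro ex1I[of _ f0]) auto
  qed
  then show ?thesis
    using assms(1) gens stanley_space_monomial unfolding stanley_decomposition_def by auto
qed

end

section \<open>The monomials of an edge ideal\<close>

definition sqfree :: "'v::finite set \<Rightarrow> 'v \<Rightarrow>\<^sub>0 nat" where
  "sqfree F = (\<Sum>v\<in>F. Poly_Mapping.single v 1)"

lemma lookup_sqfree: "Poly_Mapping.lookup (sqfree F) v = (if v \<in> F then 1 else 0)"
  by (simp add: sqfree_def Poly_Mapping.lookup_sum lookup_single when_def sum.delta)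

lemma keys_sqfree [simp]: "Poly_Mapping.keys (sqfree F) = F"
  by (auto simp: in_keys_iff lookup_sqfree split: if_splits)

lemma sqfree_insert_in_cone:
  assumes "w \<notin> F" "w \<in> Z"
  shows "sqfree (insert w F) \<in> cone (sqfree F) Z"
  using assms by (auto simp: cone_def sqfree_def intro!: exI[of _ "Poly_Mapping.single w 1"] add.commute)

text \<open>
  A monomial is divisible by the product over \<open>F\<close>, with a quotient in the variables of \<open>F\<close>, iff its
  support is \<open>F\<close>. Hence the cones with apex \<open>sqfree F\<close> and directions \<open>F\<close> partition all monomials.
\<close>

lemma sqfree_cone_self: "m \<in> cone (sqfree F) F \<longleftrightarrow> Poly_Mapping.keys m = F"
proof
  assume "m \<in> cone (sqfree F) F"
  then obtain b where "Poly_Mapping.keys b \<subseteq> F" "m = sqfree F + b" by (auto simp: cone_def)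
  then show "Poly_Mapping.keys m = F"
    by (fastforce simp: in_keys_iff lookup_add lookup_sqfree subset_iff split: if_splits)
next
  assume m: "Poly_Mapping.keys m = F"
  have "m = sqfree F + (m - sqfree F)"
    using m by (intro poly_mapping_eqI) (auto simp: lookup_add lookup_minus lookup_sqfree in_keys_iff)
  moreover have "Poly_Mapping.keys (m - sqfree F) \<subseteq> F"
    using m by (auto simp: in_keys_iff lookup_minus)
  ultimately show "m \<in> cone (sqfree F) F" unfolding cone_def by blast
qed

text \<open>The edge ideal is squarefree, so membership of a monomial depends on its support alone.\<close>

lemma edge_ideal_support:
  assumes "\<And>e. e \<in> E \<Longrightarrow> card e = 2"
  shows "edge_ideal E = {p. Poly_Mapping.keys p \<subseteq> {m. \<exists>e\<in>E. e \<subseteq> Poly_Mapping.keys m}}"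
proof -
  have support: "(\<exists>u v b. {u, v} \<in> E \<and> m = Poly_Mapping.single u 1 + Poly_Mapping.single v 1 + b) \<longleftrightarrow>
      (\<exists>e\<in>E. e \<subseteq> Poly_Mapping.keys m)" (is "?L \<longleftrightarrow> ?R") for m :: "'a \<Rightarrow>\<^sub>0 nat"
  proof
    assume ?L
    then obtain u v b where *: "{u, v} \<in> E"
      "m = Poly_Mapping.single u 1 + Poly_Mapping.single v 1 + b" by blast
    have "u \<in> Poly_Mapping.keys m" "v \<in> Poly_Mapping.keys m"
      by (simp_all add: *(2) in_keys_iff lookup_add)
    then show ?R by (intro bexI[OF _ *(1)]) simp
  next
    assume ?R
    then obtain e where e: "e \<in> E" "e \<subseteq> Poly_Mapping.keys m" by blast
    then obtain u v where uv: "e = {u, v}" "u \<noteq> v"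
      using assms[OF e(1)] unfolding card_2_iff by blast
    let ?a = "Poly_Mapping.single u 1 + Poly_Mapping.single v 1 :: 'a \<Rightarrow>\<^sub>0 nat"
    have "m = ?a + (m - ?a)"
      using e(2) uv by (intro poly_mapping_eqI)
        (auto simp: lookup_add lookup_minus lookup_single when_def in_keys_iff)
    then show ?L using e(1) uv(1) by blast
  qed
  show ?thesis
    by (rule set_eqI, unfold edge_ideal_iff mem_Collect_eq support, blast)
qed

text \<open>
  An apex \<open>a\<close> in the edge ideal that divides the monomial of an edge \<open>e\<close> has a support
  within \<open>e\<close> that contains an edge; as both edges have two elements, that edge is \<open>e\<close>.
\<close>

lemma minimal_generator:
  assumes E: "\<And>e. e \<in> E \<Longrightarrow> card e = 2" and e: "e \<in> E"
    and a: "\<exists>e'\<in>E. e' \<subseteq> Poly_Mapping.keys a" and cone: "sqfree e \<in> cone a Z"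
  shows "a = sqfree e"
proof -
  obtain b where b: "sqfree e = a + b" using cone by (auto simp: cone_def)
  then have le: "Poly_Mapping.lookup a v \<le> (if v \<in> e then 1 else 0)" for v
  proof -
    have "Poly_Mapping.lookup a v \<le> Poly_Mapping.lookup (sqfree e) v"
      unfolding b lookup_add by simp
    then show ?thesis by (simp only: lookup_sqfree)
  qed
  then have "Poly_Mapping.keys a \<subseteq> e" by (force simp: in_keys_iff split: if_splits)
  moreover obtain e' where e': "e' \<in> E" "e' \<subseteq> Poly_Mapping.keys a" using a by blast
  ultimately have "e' \<subseteq> e" by blast
  then have "e' = e" by (rule card_subset_eq[OF finite]) (simp add: E e e'(1))
  then have ge: "v \<in> e \<Longrightarrow> Poly_Mapping.lookup a v \<noteq> 0" for v
    using e'(2) by (auto simp: in_keys_iff)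
  show ?thesis
  proof (rule poly_mapping_eqI)
    fix v show "Poly_Mapping.lookup a v = Poly_Mapping.lookup (sqfree e) v"
      using le[of v] ge[of v] by (auto simp: lookup_sqfree split: if_splits)
  qed
qed

lemma monomial_ideal_edge_ideal:
  assumes "\<And>e. e \<in> E \<Longrightarrow> card e = 2"
  shows "monomial_ideal (edge_ideal E :: ('v::finite, 'k::field) poly_ring set)
    {m. \<exists>e\<in>E. e \<subseteq> Poly_Mapping.keys m}"
  by (intro monomial_ideal.intro multigraded_module_edge_ideal monomial_ideal_axioms.intro
      edge_ideal_support assms)

section \<open>The Stanley depth of the edge ideal of a graph\<close>

text \<open>
  The monomial of an edge \<open>e\<close> is the apex of a cone with directions \<open>Z e\<close>, and each
  \<open>w \<in> Z e - e\<close> leads to the monomial of the triple \<open>insert w e\<close> within that cone. The triple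
  determines the cone by disjointness, the cone its apex \<open>e\<close>, and both together \<open>w\<close>.
\<close>

lemma edge_ideal_decomposition_bound:
  fixes E :: "'v::finite set set" and D :: "(('v, 'k::field) poly_ring \<times> 'v set) list"
  assumes E: "\<And>e. e \<in> E \<Longrightarrow> card e = 2"
    and D: "multigraded_module.stanley_decomposition (*) (edge_ideal E) (ideal_comp (edge_ideal E)) D"
    and s: "\<And>u Z. (u, Z) \<in> set D \<Longrightarrow> s \<le> card Z"
  shows "card E * (s - 2) \<le> card {F. card F = 3 \<and> (\<exists>e\<in>E. e \<subseteq> F)}"
proof -
  interpret monomial_ideal "edge_ideal E :: ('v, 'k) poly_ring set" "{m. \<exists>e\<in>E. e \<subseteq> Poly_Mapping.keys m}"
    using E by (rule monomial_ideal_edge_ideal)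
  have "\<exists>i c. i < length D \<and> c \<noteq> 0 \<and> fst (D ! i) = Poly_Mapping.single (sqfree e) c" if "e \<in> E" for e
  proof -
    have "sqfree e \<in> {m. \<exists>e\<in>E. e \<subseteq> Poly_Mapping.keys m}" using that by auto
    then obtain i a c where ia: "i < length D" "c \<noteq> 0" "fst (D ! i) = Poly_Mapping.single a c"
      "a \<in> {m. \<exists>e\<in>E. e \<subseteq> Poly_Mapping.keys m}" "sqfree e \<in> cone a (snd (D ! i))"
      by (rule stanley_decomposition_covers[OF D])
    have "\<exists>e'\<in>E. e' \<subseteq> Poly_Mapping.keys a" using ia(4) by (rule CollectD)
    from minimal_generator[OF E that this ia(5)] have "a = sqfree e" by this
    then show ?thesis using ia(1-3) by blast
  qed
  then obtain i c where ic: "\<And>e. e \<in> E \<Longrightarrow> i e < length D" "\<And>e. e \<in> E \<Longrightarrow> c e \<noteq> 0"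
    "\<And>e. e \<in> E \<Longrightarrow> fst (D ! i e) = Poly_Mapping.single (sqfree e) (c e)" by metis
  define Z where "Z e = snd (D ! i e)" for e
  have inj: "inj_on (\<lambda>(e, w). insert w e) (SIGMA e:E. Z e - e)"
  proof (rule inj_onI, clarify)
    fix e w e' w' assume *: "e \<in> E" "w \<in> Z e" "w \<notin> e" "e' \<in> E" "w' \<in> Z e'" "w' \<notin> e'"
      "insert w e = insert w' e'"
    have "i e = i e'"
    proof (rule stanley_decomposition_disjoint[OF D])
      show "sqfree (insert w e) \<in> {m. \<exists>e\<in>E. e \<subseteq> Poly_Mapping.keys m}" using *(1) by auto
      show "sqfree (insert w e) \<in> cone (sqfree e) (snd (D ! i e))"
        using *(2,3) unfolding Z_def by (intro sqfree_insert_in_cone)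
      show "sqfree (insert w e) \<in> cone (sqfree e') (snd (D ! i e'))"
        unfolding *(7) using *(5,6) unfolding Z_def by (intro sqfree_insert_in_cone)
    qed (use ic *(1,4) in auto)
    then have "Poly_Mapping.keys (Poly_Mapping.single (sqfree e) (c e)) =
        Poly_Mapping.keys (Poly_Mapping.single (sqfree e') (c e'))"
      using ic(3) *(1,4) by metis
    then have "sqfree e = sqfree e'" using ic(2) *(1,4) by simp
    then have "e = e'" by (metis keys_sqfree)
    then show "e = e' \<and> w = w'" using *(3,6,7) by blast
  qed
  have "card E * (s - 2) = (\<Sum>e\<in>E. s - 2)" by simp
  also have "\<dots> \<le> (\<Sum>e\<in>E. card (Z e - e))"
  proof (rule sum_mono)
    fix e assume e: "e \<in> E"
    have "s \<le> card (Z e)" using s nth_mem[OF ic(1)[OF e]] by (auto simp: Z_def) (metis prod.collapse)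
    then show "s - 2 \<le> card (Z e - e)" using diff_card_le_card_Diff[of e "Z e"] E[OF e] by simp
  qed
  also have "\<dots> = card ((\<lambda>(e, w). insert w e) ` (SIGMA e:E. Z e - e))"
    by (simp add: card_image[OF inj])
  also have "\<dots> \<le> card {F. card F = 3 \<and> (\<exists>e\<in>E. e \<subseteq> F)}"
    by (rule card_mono) (use E in \<open>auto simp: card_insert_if\<close>)
  finally show ?thesis .
qed

text \<open>The decomposition \<open>I = \<Oplus> x\<^sub>F K[F]\<close> over all vertex sets \<open>F\<close> that contain an edge.\<close>

lemma edge_ideal_decomposition_exists:
  assumes E: "\<And>e. e \<in> E \<Longrightarrow> card e = 2" and "E \<noteq> {}"
  shows "\<exists>D. multigraded_module.stanley_decomposition (*)
    (edge_ideal E :: ('v::finite, 'k::field) poly_ring set) (ideal_comp (edge_ideal E)) D"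
proof -
  interpret monomial_ideal "edge_ideal E :: ('v, 'k) poly_ring set" "{m. \<exists>e\<in>E. e \<subseteq> Poly_Mapping.keys m}"
    using E by (rule monomial_ideal_edge_ideal)
  obtain Fs where Fs: "set Fs = {F. \<exists>e\<in>E. e \<subseteq> F}" "distinct Fs"
    using finite_distinct_list[of "{F. \<exists>e\<in>E. e \<subseteq> F}"] by auto
  let ?cs = "map (\<lambda>F. (sqfree F, F)) Fs"
  have "stanley_decomposition (map (\<lambda>(a, Z). (Poly_Mapping.single a 1, Z)) ?cs)"
  proof (rule stanley_decompositionI)
    show "?cs \<noteq> []" using Fs(1) assms(2) by auto
    show "a \<in> {m. \<exists>e\<in>E. e \<subseteq> Poly_Mapping.keys m}" if "(a, Z) \<in> set ?cs" for a Z
    proof -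
      have "Z \<in> set Fs" "a = sqfree Z" using that by auto
      then show ?thesis unfolding Fs(1) mem_Collect_eq keys_sqfree by simp
    qed
    fix m :: "'v \<Rightarrow>\<^sub>0 nat" assume "m \<in> {m. \<exists>e\<in>E. e \<subseteq> Poly_Mapping.keys m}"
    then have "\<exists>!i. i < length Fs \<and> Fs ! i = Poly_Mapping.keys m"
      using Fs by (intro distinct_Ex1) auto
    moreover have "(i < length ?cs \<and> m \<in> cone (fst (?cs ! i)) (snd (?cs ! i))) \<longleftrightarrow>
        (i < length Fs \<and> Fs ! i = Poly_Mapping.keys m)" for i
      by (cases "i < length Fs") (auto simp: sqfree_cone_self)
    ultimately show "\<exists>!i. i < length ?cs \<and> m \<in> cone (fst (?cs ! i)) (snd (?cs ! i))"
      by (simp only:)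
  qed
  then show ?thesis by blast
qed

theorem edge_ideal_sdepth_le:
  fixes E :: "'v::finite set set"
  assumes E: "\<And>e. e \<in> E \<Longrightarrow> card e = 2" and "E \<noteq> {}"
  shows "real (ideal_sdepth (edge_ideal E :: ('v, 'k::field) poly_ring set)) \<le>
    2 + real (card {F. card F = 3 \<and> (\<exists>e\<in>E. e \<subseteq> F)}) / real (card E)"
proof -
  interpret monomial_ideal "edge_ideal E :: ('v, 'k) poly_ring set" "{m. \<exists>e\<in>E. e \<subseteq> Poly_Mapping.keys m}"
    using E by (rule monomial_ideal_edge_ideal)
  let ?S = "{decomposition_sdepth D | D. stanley_decomposition D}"
  have min: "decomposition_sdepth D \<le> card Z" if "(u, Z) \<in> set D" for D u Z
    unfolding decomposition_sdepth_def using that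
    by (intro Min_le) (auto simp: image_iff split_beta intro: bexI[of _ "(u, Z)"])
  \<comment> \<open>\<open>Max\<close> is the maximum only of a finite nonempty set.\<close>
  have "?S \<subseteq> {..card (UNIV :: 'v set)}"
  proof
    fix s assume "s \<in> ?S"
    then obtain D where D: "s = decomposition_sdepth D" "stanley_decomposition D" by blast
    then have "D \<noteq> []" by (simp add: stanley_decomposition_def)
    then obtain d where d: "d \<in> set D" using hd_in_set by blast
    obtain u Z where "d = (u, Z)" by (cases d)
    then have "(u, Z) \<in> set D" using d by simp
    then show "s \<in> {..card (UNIV :: 'v set)}"
      using min[of u Z D] card_mono[of UNIV Z] D(1) by simp
  qed
  then have "finite ?S" by (rule finite_subset) simp
  moreover have "?S \<noteq> {}" using edge_ideal_decomposition_exists[OF assms] by blast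
  ultimately have "sdepth \<in> ?S" unfolding sdepth_def by (rule Max_in)
  then obtain D where D: "sdepth = decomposition_sdepth D" "stanley_decomposition D" by blast
  have "card E * (sdepth - 2) \<le> card {F. card F = 3 \<and> (\<exists>e\<in>E. e \<subseteq> F)}"
    by (rule edge_ideal_decomposition_bound[OF E D(2)]) (simp_all add: D(1) min)
  then have "real (card E) * real (sdepth - 2) \<le> real (card {F. card F = 3 \<and> (\<exists>e\<in>E. e \<subseteq> F)})"
    unfolding of_nat_mult[symmetric] of_nat_le_iff .
  moreover have "card E > 0" using assms(2) by (simp add: card_gt_0_iff)
  ultimately have "real (sdepth - 2) \<le> real (card {F. card F = 3 \<and> (\<exists>e\<in>E. e \<subseteq> F)}) / real (card E)"
    by (simp add: field_simps)
  then show ?thesis by linarith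
qed

section \<open>Counting edges and triples in complete multipartite graphs\<close>

text \<open>
  Ordering the two parts met by an edge makes the pair of its endpoints, each in its part, unique.
\<close>

lemma card_complete_partite_edges:
  fixes V :: "nat \<Rightarrow> 'v::finite set"
  assumes "disjoint_family_on V {1..k}"
  shows "card (complete_partite_edges k V) = (\<Sum>i=1..k. \<Sum>j=i+1..k. card (V i) * card (V j))"
proof -
  let ?T = "SIGMA i:{1..k}. SIGMA j:{i+1..k}. V i \<times> V j"
  let ?f = "\<lambda>(i::nat, j::nat, u, v). {u, v}"
  have part: "i = j" if "v \<in> V i" "v \<in> V j" "i \<in> {1..k}" "j \<in> {1..k}" for v i j
    using disjoint_family_onD[OF assms that(3,4)] that(1,2) by blast
  have inj: "inj_on ?f ?T"
  proof (rule inj_onI)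
    fix x y assume xy: "x \<in> ?T" "y \<in> ?T" "?f x = ?f y"
    obtain i j u v where x: "x = (i, j, u, v)" by (cases x)
    obtain i' j' u' v' where y: "y = (i', j', u', v')" by (cases y)
    have *: "i \<in> {1..k}" "j \<in> {i+1..k}" "u \<in> V i" "v \<in> V j"
      "i' \<in> {1..k}" "j' \<in> {i'+1..k}" "u' \<in> V i'" "v' \<in> V j'" "{u, v} = {u', v'}"
      using xy unfolding x y by simp_all
    have j: "j \<in> {1..k}" "j' \<in> {1..k}" using * by auto
    from *(9) consider "u = u'" "v = v'" | "u = v'" "v = u'" by (auto simp: doubleton_eq_iff)
    then show "x = y"
    proof cases
      case 1
      then have "i = i'" "j = j'"
        using part[of u i i'] part[of v j j'] *(1,3-5,7,8) j by simp_all
      then show ?thesis using 1 x y by simp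
    next
      case 2
      then have "i = j'" "j = i'"
        using part[of u i j'] part[of v j i'] *(1,3-5,7,8) j by simp_all
      then show ?thesis using *(2,6) by simp
    qed
  qed
  have image: "?f ` ?T = complete_partite_edges k V"
  proof (intro equalityI subsetI)
    fix e assume "e \<in> ?f ` ?T"
    then obtain x where "x \<in> ?T" "e = ?f x" by blast
    then obtain i j u v where *: "e = {u, v}" "i \<in> {1..k}" "j \<in> {i+1..k}" "u \<in> V i" "v \<in> V j"
      by (cases x) auto
    then have "j \<in> {1..k}" "i \<noteq> j" by auto
    then show "e \<in> complete_partite_edges k V"
      unfolding complete_partite_edges_def using * by blast
  next
    fix e assume "e \<in> complete_partite_edges k V"
    then obtain u v i j where *: "e = {u, v}" "i \<in> {1..k}" "j \<in> {1..k}" "i \<noteq> j" "u \<in> V i" "v \<in> V j"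
      unfolding complete_partite_edges_def by blast
    show "e \<in> ?f ` ?T"
    proof (cases "i < j")
      case True
      then show ?thesis using * by (intro image_eqI[of _ _ "(i, j, u, v)"]) auto
    next
      case False
      then show ?thesis using * by (intro image_eqI[of _ _ "(j, i, v, u)"]) auto
    qed
  qed
  have "card (complete_partite_edges k V) = card ?T"
    unfolding image[symmetric] by (rule card_image[OF inj])
  then show ?thesis by simp
qed

text \<open>A triple contains no edge iff it lies inside a single part.\<close>

lemma card_triples_with_edge:
  fixes V :: "nat \<Rightarrow> 'v::finite set"
  assumes disj: "disjoint_family_on V {1..k}" and cover: "(\<Union>i\<in>{1..k}. V i) = UNIV"
  shows "card {F. card F = 3 \<and> (\<exists>e\<in>complete_partite_edges k V. e \<subseteq> F)} +
    (\<Sum>i=1..k. card (V i) choose 3) = card (UNIV :: 'v set) choose 3"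
proof -
  let ?W = "{F. card F = 3 \<and> (\<exists>e\<in>complete_partite_edges k V. e \<subseteq> F)}"
  let ?N = "\<Union>i\<in>{1..k}. {F. F \<subseteq> V i \<and> card F = 3}"
  have part: "i = j" if "v \<in> V i" "v \<in> V j" "i \<in> {1..k}" "j \<in> {1..k}" for v i j
    using disjoint_family_onD[OF disj that(3,4)] that(1,2) by blast
  have dis: "?W \<inter> ?N = {}"
  proof (rule equals0I)
    fix F assume F: "F \<in> ?W \<inter> ?N"
    then obtain u v i j where e: "{u, v} \<subseteq> F"
      "i \<in> {1..k}" "j \<in> {1..k}" "i \<noteq> j" "u \<in> V i" "v \<in> V j"
      unfolding complete_partite_edges_def by blast
    obtain l where "l \<in> {1..k}" "F \<subseteq> V l" using F by blast
    then have "i = l" "j = l" using part[of u i l] part[of v j l] e by auto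
    then show False using e(4) by simp
  qed
  have all: "?W \<union> ?N = {F. F \<subseteq> UNIV \<and> card F = 3}"
  proof (intro equalityI subsetI)
    fix F :: "'v set" assume F: "F \<in> {F. F \<subseteq> UNIV \<and> card F = 3}"
    then obtain u where u: "u \<in> F" by fastforce
    obtain i where i: "i \<in> {1..k}" "u \<in> V i" using cover by blast
    show "F \<in> ?W \<union> ?N"
    proof (cases "F \<subseteq> V i")
      case True
      then show ?thesis using F i by auto
    next
      case False
      then obtain v where v: "v \<in> F" "v \<notin> V i" by blast
      obtain j where j: "j \<in> {1..k}" "v \<in> V j" using cover by blast
      then have "{u, v} \<in> complete_partite_edges k V"
        using i v unfolding complete_partite_edges_def by blast
      moreover have "{u, v} \<subseteq> F" using u v by simp
      ultimately show ?thesis using F by blast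
    qed
  qed auto
  have "card ?N = (\<Sum>i=1..k. card {F. F \<subseteq> V i \<and> card F = 3})"
  proof (rule card_UN_disjoint)
    show "\<forall>i\<in>{1..k}. \<forall>j\<in>{1..k}. i \<noteq> j \<longrightarrow>
        {F. F \<subseteq> V i \<and> card F = 3} \<inter> {F. F \<subseteq> V j \<and> card F = 3} = {}"
    proof (intro ballI impI equals0I)
      fix i j F assume ij: "i \<in> {1..k}" "j \<in> {1..k}" "i \<noteq> j"
        and F: "F \<in> {F. F \<subseteq> V i \<and> card F = 3} \<inter> {F. F \<subseteq> V j \<and> card F = 3}"
      then obtain v where "v \<in> F" by fastforce
      then show False using part ij F by blast
    qed
  qed auto
  then have "card ?N = (\<Sum>i=1..k. card (V i) choose 3)" by (simp add: n_subsets)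
  moreover have "card ?W + card ?N = card (UNIV :: 'v set) choose 3"
    using card_Un_disjoint[of ?W ?N] dis all n_subsets[of "UNIV :: 'v set" 3] by simp
  ultimately show ?thesis by simp
qed

section \<open>The bound for complete multipartite graphs\<close>

theorem lemma2p4:
  fixes k n :: nat and r :: "nat \<Rightarrow> nat" and V :: "nat \<Rightarrow> 'v::finite set"
    and I :: "('v, 'k::field) poly_ring set"
  assumes "k \<ge> 2"
    and "2 \<le> r 1"
    and "\<forall>i\<in>{1..k}. \<forall>j\<in>{1..k}. i \<le> j \<longrightarrow> r i \<le> r j"
    and "n = (\<Sum>i=1..k. r i)"
    and "disjoint_family_on V {1..k}"
    and "(\<Union>i\<in>{1..k}. V i) = UNIV"
    and "\<forall>i\<in>{1..k}. card (V i) = r i"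
    and "I = edge_ideal (complete_partite_edges k V)"
  shows "real (ideal_sdepth I) \<le>
    2 + (real (n choose 3) - (\<Sum>i=1..k. real (r i choose 3)))
        / (\<Sum>i=1..k. \<Sum>j=i+1..k. real (r i * r j))"
proof -
  let ?E = "complete_partite_edges k V"
  have card2: "card e = 2" if e: "e \<in> ?E" for e
  proof -
    obtain u v i j where *: "e = {u, v}" "i \<in> {1..k}" "j \<in> {1..k}" "i \<noteq> j" "u \<in> V i" "v \<in> V j"
      using e unfolding complete_partite_edges_def by blast
    then have "u \<noteq> v" using disjoint_family_onD[OF assms(5), of i j] by blast
    then show ?thesis using * by simp
  qed
  have "r 1 \<le> r 2" using assms(1,3) by simp
  then have "card (V 1) \<noteq> 0" "card (V 2) \<noteq> 0" using assms(1,2,7) by auto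
  then obtain u v where "u \<in> V 1" "v \<in> V 2" by fastforce
  moreover have "(1::nat) \<in> {1..k}" "2 \<in> {1..k}" "1 \<noteq> (2::nat)" using assms(1) by simp_all
  ultimately have "{u, v} \<in> ?E"
    unfolding complete_partite_edges_def by blast
  then have "?E \<noteq> {}" by blast
  have n: "card (UNIV :: 'v set) = n"
    using card_UN_disjoint[of "{1..k}" V] assms(4-7) by (simp add: disjoint_family_on_def)
  have "real (card {F. card F = 3 \<and> (\<exists>e\<in>?E. e \<subseteq> F)}) =
      real (n choose 3) - (\<Sum>i=1..k. real (r i choose 3))"
  proof -
    have "(\<Sum>i=1..k. card (V i) choose 3) = (\<Sum>i=1..k. r i choose 3)"
      using assms(7) by (intro sum.cong) auto
    then have "card {F. card F = 3 \<and> (\<exists>e\<in>?E. e \<subseteq> F)} + (\<Sum>i=1..k. r i choose 3) = n choose 3"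
      using card_triples_with_edge[OF assms(5,6)] n by simp
    from this[symmetric] show ?thesis by simp
  qed
  moreover have "real (card ?E) = (\<Sum>i=1..k. \<Sum>j=i+1..k. real (r i * r j))"
  proof -
    have "(\<Sum>i=1..k. \<Sum>j=i+1..k. card (V i) * card (V j)) = (\<Sum>i=1..k. \<Sum>j=i+1..k. r i * r j)"
      using assms(7) by (intro sum.cong) auto
    then show ?thesis using card_complete_partite_edges[OF assms(5)] by simp
  qed
  ultimately show ?thesis
    using edge_ideal_sdepth_le[OF card2 \<open>?E \<noteq> {}\<close>, where 'k = 'k] assms(8) by simp
qed

end
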